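(* Let $m_1,m_2$ be positive integers and let $f_1,f_2:\mathbb{N}\to\mathbb{C}$ be two multiplicative functions, with periods $m_1$ and $m_2$ respectively, such that, for each $j\in\{1,2\}$: (i) for some prime $q\mid m_j$, $\sum_{k=0}^\infty \frac{f_j(q^k)}{q^k}=0$; (ii) for each prime power $p^a\,\|\,m_j$ ($p$ prime), $f_j(p^k)=f_j(p^a)$ for all $k\geq a$; (iii) for each prime $p$ with $\gcd(p,m_j)=1$, $f_j(p^k)=1$ for all $k\geq 1$. Let $f=f_1\ast f_2$, and let $\alpha=\inf\{a>0:\Delta(x)=O_a(x^a)\}$. Then, for all $\epsilon>0$, $$\sum_{n\leq x}f(n)=O_\epsilon(x^{\alpha+\epsilon}).$$
   Context: $\mathbb{N}=\{1,2,3,\dots\}$. A function $f:\mathbb{N}\to\mathbb{C}$ is multiplicative if $f(1)=1$ and $f(nm)=f(n)f(m)$ whenever $n$ and $m$ are relatively prime. $f$ has period $m$ if $f(n+m)=f(n)$ for all $n\in\mathbb{N}$ ($m$ not necessarily minimal). The notation $p^a\,\|\,m$ means that $p^a$ is the largest power of $p$ dividing $m$. $\ast$ denotes Dirichlet convolution, $(f_1\ast f_2)(n)=\sum_{d\mid n}f_1(d)f_2(n/d)$. $\tau(n)=\sum_{d\mid n}1$ is the divisor function, and $\Delta(x)$ is defined by $$\sum_{n\leq x}\tau(n)=x\log x+(2\gamma-1)x+\Delta(x),$$ where $\gamma$ is the Euler–Mascheroni constant. $O$-estimates are for all sufficiently large $x$; the subscript in $O_a$, $O_\epsilon$ means the implied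 constant may depend on that parameter (and, in the conclusion, on the fixed functions $f_1,f_2$). *)

theory Defs
  imports
    "HOL-Analysis.Analysis"
    "HOL-Computational_Algebra.Primes"
    "HOL-Library.Landau_Symbols"
begin

text \<open>Arithmetic functions on the positive integers are functions on \<^typ>\<open>nat\<close> whose value at
  \<open>0\<close> is never constrained or used.\<close>

definition multiplicative_fun :: "(nat \<Rightarrow> complex) \<Rightarrow> bool" where
  "multiplicative_fun f \<longleftrightarrow>
     f 1 = 1 \<and> (\<forall>n m. n > 0 \<longrightarrow> m > 0 \<longrightarrow> coprime n m \<longrightarrow> f (n * m) = f n * f m)"

definition has_period :: "(nat \<Rightarrow> complex) \<Rightarrow> nat \<Rightarrow> bool" where
  "has_period f m \<longleftrightarrow> (\<forall>n>0. f (n + m) = f n)"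

definition dirichlet_conv :: "(nat \<Rightarrow> complex) \<Rightarrow> (nat \<Rightarrow> complex) \<Rightarrow> nat \<Rightarrow> complex" where
  "dirichlet_conv f g n = (\<Sum>d | d dvd n. f d * g (n div d))"

definition divisor_tau :: "nat \<Rightarrow> nat" where
  "divisor_tau n = (\<Sum>d | d dvd n. 1)"

definition summatory :: "(nat \<Rightarrow> 'a :: comm_monoid_add) \<Rightarrow> real \<Rightarrow> 'a" where
  "summatory f x = (\<Sum>n | n > 0 \<and> real n \<le> x. f n)"

definition divisor_Delta :: "real \<Rightarrow> real" where
  "divisor_Delta x =
     summatory (\<lambda>n. real (divisor_tau n)) x - (x * ln x + (2 * euler_mascheroni - 1) * x)"

text \<open>The set below contains every \<open>a \<ge> 1\<close> and is bounded below by \<open>0\<close>, so the conditionally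
  complete infimum on the reals is the genuine one.\<close>

definition divisor_alpha :: real where
  "divisor_alpha = Inf {a :: real. a > 0 \<and> divisor_Delta \<in> O(\<lambda>x. x powr a)}"

end

theory Submission
  imports Defs "HOL-Real_Asymp.Real_Asymp"
begin

text \<open>
  The values of \<open>f\<^sub>j\<close> at the powers of a prime are constant from the exponent of that prime in
  \<open>m\<^sub>j\<close> on, so its Moebius transform
  \<open>g\<^sub>j = \<mu> \<star> f\<^sub>j\<close> (where \<open>\<star>\<close> is Dirichlet convolution) lives on the divisors of \<open>m\<^sub>j\<close>: on prime
  powers it is the difference of consecutive values of \<open>f\<^sub>j\<close>, and these differences vanish beyond
  the power of the prime in \<open>m\<^sub>j\<close> (\<open>mobius_transform_support\<close>). Since \<open>f\<^sub>j = 1 \<star> g\<^sub>j\<close>, the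
  convolution \<open>f\<^sub>1 \<star> f\<^sub>2 = \<tau> \<star> g\<^sub>1 \<star> g\<^sub>2\<close> is a finite combination of dilates of the
  divisor function, and its summatory function at \<open>x\<close> is the combination, with weights
  \<open>g\<^sub>1 a * g\<^sub>2 b\<close>, of the divisor sums up to \<open>x / (a b)\<close>.

  Inserting the asymptotic expansion of the divisor sum, the main term is
  \<open>x * (\<Sum>a. \<Sum>b. (g\<^sub>1 a / a) * (g\<^sub>2 b / b) * (ln x - ln a - ln b + 2 * \<gamma> - 1))\<close>.
  It vanishes identically because both sums \<open>G\<^sub>j = (\<Sum>a. g\<^sub>j a / a)\<close> are zero: each of its
  pieces contains at least one full factor \<open>G\<^sub>1\<close> or \<open>G\<^sub>2\<close>; put differently, the Dirichlet series
  of \<open>g\<^sub>1 \<star> g\<^sub>2\<close> has a zero of order at least two at \<open>1\<close>, which cancels the double pole of \<open>\<zeta>\<^sup>2\<close>. By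
  multiplicativity \<open>G\<^sub>j\<close> contains the Euler factor at \<open>q\<close>, which is \<open>1 - 1/q\<close> times the series
  \<open>\<Sum>k. f\<^sub>j (q ^ k) / q ^ k = 0\<close> (\<open>sum_mobius_transform_over_d_eq_0\<close>). What remains is a finite
  combination of the values \<open>\<Delta> (x / (a b))\<close> (\<open>summatory_conv_eq_sum_Delta\<close>), each of which is of
  order \<open>x\<close> to the power \<open>\<alpha> + \<epsilon>\<close>.
\<close>

section \<open>Sums over divisors\<close>

lemma sum_divisors_coprime:
  fixes \<phi> :: "nat \<Rightarrow> 'a :: comm_monoid_add"
  assumes "coprime a b"
  shows "(\<Sum>d | d dvd a * b. \<phi> d) = (\<Sum>d | d dvd a. \<Sum>e | e dvd b. \<phi> (d * e))"
proof -
  have gcds: "gcd (d * e) a = d" "gcd (d * e) b = e" if "d dvd a" "e dvd b" for d e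
  proof -
    have "coprime a e" "coprime b d"
      using assms that by (meson coprime_commute coprime_divisors dvd_refl)+
    thus "gcd (d * e) a = d" "gcd (d * e) b = e"
      using that by (simp_all add: gcd_mult_left_right_cancel gcd_mult_left_left_cancel)
  qed
  have "bij_betw (\<lambda>(d, e). d * e) ({d. d dvd a} \<times> {e. e dvd b}) {d. d dvd a * b}"
  proof (rule bij_betw_imageI)
    show "inj_on (\<lambda>(d, e). d * e) ({d. d dvd a} \<times> {e. e dvd b})"
      by (auto intro!: inj_onI) (metis gcds)+
    show "(\<lambda>(d, e). d * e) ` ({d. d dvd a} \<times> {e. e dvd b}) = {d. d dvd a * b}"
    proof (intro equalityI subsetI)
      fix n assume "n \<in> {d. d dvd a * b}"
      then obtain d e where "n = d * e" "d dvd a" "e dvd b"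
        using division_decomp[of n a b] by blast
      thus "n \<in> (\<lambda>(d, e). d * e) ` ({d. d dvd a} \<times> {e. e dvd b})"
        by auto
    qed (auto intro: mult_dvd_mono)
  qed
  from sum.reindex_bij_betw[OF this, of \<phi>]
  show ?thesis
    by (simp add: sum.cartesian_product case_prod_unfold)
qed

lemma sum_divisors_prime_power:
  fixes \<phi> :: "nat \<Rightarrow> 'a :: comm_monoid_add"
  assumes "prime p"
  shows "(\<Sum>d | d dvd p ^ k. \<phi> d) = (\<Sum>i\<le>k. \<phi> (p ^ i))"
proof -
  have "{d. d dvd p ^ k} = (\<lambda>i. p ^ i) ` {..k}"
    using divides_primepow_nat[OF assms] by (auto simp: le_imp_power_dvd)
  moreover have "inj_on (\<lambda>i. p ^ i) {..k}"
    using assms prime_gt_1_nat by (auto intro!: inj_onI simp: power_inject_exp)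
  ultimately show ?thesis
    by (simp add: sum.reindex)
qed

section \<open>The Moebius transform of a multiplicative function\<close>

text \<open>For multiplicative \<open>f\<close> this is the Dirichlet convolution \<open>\<mu> \<star> f\<close>. Writing it as a product over
  primes makes multiplicativity and the vanishing of values immediate, at the price of having to
  prove the inversion formula.\<close>

definition mobius_transform :: "(nat \<Rightarrow> complex) \<Rightarrow> nat \<Rightarrow> complex" where
  "mobius_transform f n =
     (\<Prod>p\<in>prime_factors n. f (p ^ multiplicity p n) - f (p ^ (multiplicity p n - 1)))"

lemma mobius_transform_1 [simp]: "mobius_transform f (Suc 0) = 1"
  by (simp add: mobius_transform_def)

lemma mobius_transform_prime_power:
  assumes "prime p"
  shows "mobius_transform f (p ^ Suc k) = f (p ^ Suc k) - f (p ^ k)"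
proof -
  have "prime_factors (p ^ Suc k) = {p}"
    using assms by (simp add: prime_factorization_prime_power del: power_Suc)
  thus ?thesis
    using assms unfolding mobius_transform_def by (simp del: power_Suc)
qed

lemma mobius_transform_mult:
  assumes "a > 0" "b > 0" "coprime a b"
  shows "mobius_transform f (a * b) = mobius_transform f a * mobius_transform f b"
proof -
  let ?h = "\<lambda>n p. f (p ^ multiplicity p n) - f (p ^ (multiplicity p n - 1))"
  have disj: "prime_factors a \<inter> prime_factors b = {}"
    using assms by (auto simp: prime_factors_dvd dest: coprime_common_divisor)
  have left: "?h (a * b) p = ?h a p" if "p \<in> prime_factors a" for p
  proof -
    have "\<not> p dvd b" "prime p"
      using disj that assms by (auto simp: prime_factors_dvd)
    thus ?thesis
      using assms by (simp add: prime_elem_multiplicity_mult_distrib not_dvd_imp_multiplicity_0)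
  qed
  have right: "?h (a * b) p = ?h b p" if "p \<in> prime_factors b" for p
  proof -
    have "\<not> p dvd a" "prime p"
      using disj that assms by (auto simp: prime_factors_dvd)
    thus ?thesis
      using assms by (simp add: prime_elem_multiplicity_mult_distrib not_dvd_imp_multiplicity_0)
  qed
  have "mobius_transform f (a * b) = (\<Prod>p\<in>prime_factors a \<union> prime_factors b. ?h (a * b) p)"
    using assms unfolding mobius_transform_def by (simp add: prime_factors_product)
  also have "\<dots> = (\<Prod>p\<in>prime_factors a. ?h (a * b) p) * (\<Prod>p\<in>prime_factors b. ?h (a * b) p)"
    using disj by (intro prod.union_disjoint) auto
  also have "\<dots> = mobius_transform f a * mobius_transform f b"
    using left right unfolding mobius_transform_def by (simp cong: prod.cong)
  finally show ?thesis .
qed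

text \<open>Moebius inversion: both sides are multiplicative, and at a prime power the left-hand side
  telescopes. The induction splits off one full prime power at a time.\<close>

lemma sum_divisors_mobius_transform:
  assumes "multiplicative_fun f" "n > 0"
  shows "(\<Sum>d | d dvd n. mobius_transform f d) = f n"
  using assms(2)
proof (induction n rule: less_induct)
  case (less n)
  show ?case
  proof (cases "n = 1")
    case True
    thus ?thesis using assms(1) by (simp add: multiplicative_fun_def)
  next
    case False
    then obtain p where p: "prime p" "p dvd n"
      using prime_factor_nat by blast
    define k where "k = multiplicity p n"
    have "n \<noteq> 0" "\<not> is_unit p"
      using less.prems p by (auto simp: not_prime_unit)
    then obtain b where b: "n = p ^ k * b" "\<not> p dvd b"
      unfolding k_def by (rule multiplicity_decompose')
    have "k > 0"
      using p less.prems by (simp add: k_def prime_multiplicity_gt_zero_iff)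
    have "b > 0" using b less.prems by (cases "b = 0") auto
    have cop: "coprime (p ^ k) b"
      using p b by (simp add: prime_imp_coprime)
    have "p ^ k > 1"
      using \<open>k > 0\<close> p by (intro one_less_power prime_gt_1_nat)
    hence "b < n" using b \<open>b > 0\<close> by simp
    have "p ^ k > 0" using p by (simp add: prime_gt_0_nat)
    have pp: "(\<Sum>i\<le>j. mobius_transform f (p ^ i)) = f (p ^ j)" for j
      using assms(1) p
      by (induction j) (simp_all add: multiplicative_fun_def mobius_transform_prime_power del: power_Suc)
    have "(\<Sum>d | d dvd n. mobius_transform f d) =
            (\<Sum>d | d dvd p ^ k. \<Sum>e | e dvd b. mobius_transform f (d * e))"
      unfolding b by (rule sum_divisors_coprime[OF cop])
    also have "\<dots> = (\<Sum>d | d dvd p ^ k. \<Sum>e | e dvd b. mobius_transform f d * mobius_transform f e)"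
    proof (intro sum.cong refl mobius_transform_mult)
      fix d e assume de: "d \<in> {d. d dvd p ^ k}" "e \<in> {e. e dvd b}"
      show "d > 0" "e > 0"
        using de \<open>p ^ k > 0\<close> \<open>b > 0\<close> by (blast intro: dvd_pos_nat)+
      show "coprime d e"
        using de by (intro coprime_divisors[OF _ _ cop]) simp_all
    qed
    also have "\<dots> = (\<Sum>d | d dvd p ^ k. mobius_transform f d) * (\<Sum>e | e dvd b. mobius_transform f e)"
      by (simp add: sum_product)
    also have "\<dots> = f (p ^ k) * f b"
      using less.IH[OF \<open>b < n\<close> \<open>b > 0\<close>] p pp by (simp add: sum_divisors_prime_power)
    also have "\<dots> = f n"
      using assms(1) cop \<open>b > 0\<close> p unfolding b multiplicative_fun_def by (simp add: prime_gt_0_nat)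
    finally show ?thesis .
  qed
qed

text \<open>Moebius inversion with the divisor condition moved into the summand: the range of summation no
  longer depends on \<open>u\<close>, which is what allows the order of summation to be exchanged.\<close>

lemma finite_divisor_sum:
  assumes "multiplicative_fun f" "m > 0" "u > 0"
    and supp: "\<And>n. n > 0 \<Longrightarrow> mobius_transform f n \<noteq> 0 \<Longrightarrow> n dvd m"
  shows "f u = (\<Sum>a | a dvd m. if a dvd u then mobius_transform f a else 0)"
proof -
  have "f u = (\<Sum>d | d dvd u. mobius_transform f d)"
    using sum_divisors_mobius_transform[OF assms(1,3)] by simp
  also have "\<dots> = (\<Sum>d\<in>{a. a dvd m} \<inter> {a. a dvd u}. mobius_transform f d)"
    using \<open>u > 0\<close> supp by (intro sum.mono_neutral_right) (auto dest: dvd_pos_nat)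
  also have "\<dots> = (\<Sum>a | a dvd m. if a dvd u then mobius_transform f a else 0)"
    using \<open>m > 0\<close> by (simp add: sum.If_cases)
  finally show ?thesis .
qed

text \<open>If \<open>p\<close> divides \<open>n\<close> to a higher power than it divides \<open>m\<close>, the factor at \<open>p\<close> is a difference of two
  values of \<open>f\<close> from the range of exponents where \<open>f (p ^ k)\<close> is constant.\<close>

lemma mobius_transform_support:
  assumes "multiplicative_fun f" "m > 0" "n > 0" "mobius_transform f n \<noteq> 0"
    and stable: "\<And>p k. prime p \<Longrightarrow> p dvd m \<Longrightarrow> k \<ge> multiplicity p m \<Longrightarrow>
           f (p ^ k) = f (p ^ multiplicity p m)"
    and triv: "\<And>p k. prime p \<Longrightarrow> coprime p m \<Longrightarrow> k \<ge> 1 \<Longrightarrow> f (p ^ k) = 1"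
  shows "n dvd m"
proof (rule multiplicity_le_imp_dvd)
  fix p :: nat assume p: "prime p"
  show "multiplicity p n \<le> multiplicity p m"
  proof (rule ccontr)
    assume gt: "\<not> multiplicity p n \<le> multiplicity p m"
    define j where "j = multiplicity p n - 1"
    have j: "multiplicity p n = Suc j" "j \<ge> multiplicity p m"
      using gt by (auto simp: j_def)
    \<comment> \<open>For \<open>p\<close> coprime to \<open>m\<close> the constant range starts at \<open>i = 0\<close>, because \<open>f 1 = 1\<close>.\<close>
    have const: "f (p ^ i) = f (p ^ multiplicity p m)" if "i \<ge> multiplicity p m" for i
    proof (cases "p dvd m")
      case False
      hence "multiplicity p m = 0" "coprime p m"
        using p by (auto simp: not_dvd_imp_multiplicity_0 prime_imp_coprime)
      thus ?thesis
        using triv[OF p, of i] assms(1) by (cases "i = 0") (auto simp: multiplicative_fun_def)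
    qed (use stable p that in blast)
    have "p \<in> prime_factors n"
      using p gt by (simp add: prime_factors_multiplicity)
    moreover have "f (p ^ multiplicity p n) - f (p ^ (multiplicity p n - 1)) = 0"
      using const[of "Suc j"] const[of j] j by simp
    ultimately show False
      using assms(4) unfolding mobius_transform_def by (auto simp: prod_zero_iff)
  qed
qed (use assms in auto)

text \<open>The sum over divisors of \<open>m\<close> splits off its Euler factor at \<open>q\<close>. Multiplying a
  power series by \<open>1 - z\<close> takes differences of consecutive coefficients; at \<open>z = 1/q\<close> this makes
  the Euler factor \<open>1 - 1/q\<close> times the given series, hence zero.\<close>

lemma sum_mobius_transform_over_d_eq_0:
  assumes mult: "multiplicative_fun f" and "m > 0" and q: "prime q"
    and sums: "(\<lambda>k. f (q ^ k) / of_nat (q ^ k)) sums 0"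
    and supp: "\<And>n. n > 0 \<Longrightarrow> mobius_transform f n \<noteq> 0 \<Longrightarrow> n dvd m"
  shows "(\<Sum>d | d dvd m. mobius_transform f d / of_nat d) = 0"
proof -
  let ?g = "mobius_transform f"
  define a where "a = multiplicity q m"
  have "m \<noteq> 0" "\<not> is_unit q"
    using \<open>m > 0\<close> q by (auto simp: not_prime_unit)
  then obtain b where b: "m = q ^ a * b" "\<not> q dvd b"
    unfolding a_def by (rule multiplicity_decompose')
  have "b > 0" using b \<open>m > 0\<close> by (cases "b = 0") auto
  have "q > 0" using q by (simp add: prime_gt_0_nat)
  hence "q ^ a > 0" by simp
  have cop: "coprime (q ^ a) b"
    using q b by (simp add: prime_imp_coprime)
  define F where "F = (\<lambda>k. f (q ^ k) / of_nat (q ^ k))"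
  define H where "H = (\<lambda>k. ?g (q ^ k) / of_nat (q ^ k))"
  have F: "F sums 0" using sums by (simp add: F_def)
  have F0: "F 0 = 1" and H0: "H 0 = 1"
    using mult by (simp_all add: F_def H_def multiplicative_fun_def)
  have HS: "H (Suc k) = F (Suc k) - F k / of_nat q" for k
    using \<open>q > 0\<close> unfolding H_def F_def mobius_transform_prime_power[OF q]
    by (simp add: field_simps)
  \<comment> \<open>\<open>H\<close> sums to \<open>(1 - 1/q) * 0\<close>: the series of \<open>F\<close> minus its own shift divided by \<open>q\<close>.\<close>
  have "(\<lambda>k. F (Suc k)) sums (- F 0)"
    using F by (simp add: sums_Suc_iff)
  hence "(\<lambda>k. H (Suc k)) sums (- F 0 - 0 / of_nat q)"
    unfolding HS by (intro sums_diff sums_divide F)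
  hence "H sums 0"
    by (simp add: sums_Suc_iff F0 H0)
  \<comment> \<open>The support condition makes this series a finite sum, namely the Euler factor at \<open>q\<close>.\<close>
  moreover have "H sums (\<Sum>k\<le>a. H k)"
  proof (rule sums_finite)
    fix k assume k: "k \<notin> {..a}"
    have "\<not> q ^ k dvd m"
      using k multiplicity_geI[OF \<open>m \<noteq> 0\<close> \<open>\<not> is_unit q\<close>, of k] by (auto simp: a_def)
    thus "H k = 0"
      using supp[of "q ^ k"] \<open>q > 0\<close> by (auto simp: H_def)
  qed auto
  ultimately have factor: "(\<Sum>k\<le>a. H k) = 0"
    by (metis sums_unique2)
  have "(\<Sum>d | d dvd m. ?g d / of_nat d) =
          (\<Sum>d | d dvd q ^ a. \<Sum>e | e dvd b. ?g (d * e) / of_nat (d * e))"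
    unfolding b by (rule sum_divisors_coprime[OF cop])
  also have "\<dots> = (\<Sum>d | d dvd q ^ a. \<Sum>e | e dvd b. (?g d / of_nat d) * (?g e / of_nat e))"
  proof (intro sum.cong refl)
    fix d e assume de: "d \<in> {d. d dvd q ^ a}" "e \<in> {e. e dvd b}"
    have "d > 0" "e > 0"
      using de \<open>b > 0\<close> \<open>q ^ a > 0\<close> by (blast intro: dvd_pos_nat)+
    moreover have "coprime d e"
      using de by (intro coprime_divisors[OF _ _ cop]) simp_all
    ultimately show "?g (d * e) / of_nat (d * e) = (?g d / of_nat d) * (?g e / of_nat e)"
      by (simp add: mobius_transform_mult)
  qed
  also have "\<dots> = (\<Sum>d | d dvd q ^ a. ?g d / of_nat d) * (\<Sum>e | e dvd b. ?g e / of_nat e)"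
    by (simp add: sum_product)
  also have "(\<Sum>d | d dvd q ^ a. ?g d / of_nat d) = (\<Sum>k\<le>a. H k)"
    unfolding H_def by (rule sum_divisors_prime_power[OF q])
  finally show ?thesis by (simp add: factor)
qed

section \<open>Convolutions as combinations of dilated divisor functions\<close>

text \<open>Factorizations \<open>n = u * v\<close> with \<open>a\<close> dividing \<open>u\<close> and \<open>b\<close> dividing \<open>v\<close> correspond to
  factorizations of \<open>n / (a * b)\<close>, via \<open>u = a * w\<close>.\<close>

lemma card_divisor_pairs:
  assumes "n > 0" "a > 0" "b > 0"
  shows "card {u. u dvd n \<and> a dvd u \<and> b dvd n div u} =
           (if a * b dvd n then divisor_tau (n div (a * b)) else 0)"
proof (cases "a * b dvd n")
  case True
  then obtain r where r: "n = a * b * r" by blast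
  have "r > 0" using \<open>n > 0\<close> unfolding r by simp
  have "{u. u dvd n \<and> a dvd u \<and> b dvd n div u} = (\<lambda>w. a * w) ` {w. w dvd r}"
  proof (intro equalityI subsetI)
    fix u assume "u \<in> {u. u dvd n \<and> a dvd u \<and> b dvd n div u}"
    then obtain w v where u: "u = a * w" and v: "n = u * (b * v)"
      by (auto elim!: dvdE) (metis assms(1) nonzero_mult_div_cancel_left mult_0 less_irrefl)
    have "a * b * r = a * b * (w * v)"
      unfolding r[symmetric] by (subst v, subst u) (simp only: mult_ac)
    hence "r = w * v" using assms(2,3) by auto
    thus "u \<in> (\<lambda>w. a * w) ` {w. w dvd r}" using u by auto
  next
    fix u assume "u \<in> (\<lambda>w. a * w) ` {w. w dvd r}"
    then obtain w v where w: "u = a * w" "r = w * v" by (auto simp: dvd_def)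
    have "n = u * (b * v)" using r w by (simp add: mult_ac)
    moreover have "u > 0" using w \<open>r > 0\<close> \<open>a > 0\<close> by simp
    ultimately show "u \<in> {u. u dvd n \<and> a dvd u \<and> b dvd n div u}"
      using w by simp
  qed
  moreover have "inj_on (\<lambda>w. a * w) {w. w dvd r}"
    using assms by (auto intro: inj_onI)
  ultimately show ?thesis
    using r assms by (simp add: card_image divisor_tau_def)
next
  case False
  have "{u. u dvd n \<and> a dvd u \<and> b dvd n div u} = {}"
  proof -
    have "a * b dvd n" if "u dvd n" "a dvd u" "b dvd n div u" for u
      using mult_dvd_mono[OF that(2,3)] that(1) by simp
    thus ?thesis using False by blast
  qed
  thus ?thesis using False by (simp only: card.empty if_False)
qed

lemma summatory_tau_multiples:
  assumes "k > 0"
  shows "(\<Sum>n | n > 0 \<and> real n \<le> x. if k dvd n then of_nat (divisor_tau (n div k)) else 0) =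
           (of_real (summatory (\<lambda>n. real (divisor_tau n)) (x / real k)) :: complex)"
proof -
  have fin: "finite {n. n > 0 \<and> real n \<le> x}"
    by (rule finite_subset[of _ "{..nat \<lfloor>x\<rfloor>}"]) (auto simp: le_nat_floor)
  have "(\<Sum>n | n > 0 \<and> real n \<le> x. if k dvd n then of_nat (divisor_tau (n div k)) else 0) =
        (\<Sum>n\<in>{n. n > 0 \<and> real n \<le> x} \<inter> {n. k dvd n}. of_nat (divisor_tau (n div k)) :: complex)"
    using fin by (simp add: sum.If_cases)
  also have "\<dots> = (\<Sum>r | r > 0 \<and> real r \<le> x / real k. of_nat (divisor_tau r))"
    by (rule sum.reindex_bij_witness[where i = "\<lambda>r. k * r" and j = "\<lambda>n. n div k"])
       (use assms in \<open>auto simp: field_simps elim!: dvdE\<close>)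
  finally show ?thesis
    by (simp add: summatory_def)
qed

text \<open>The identity \<open>(1 \<star> g\<^sub>1) \<star> (1 \<star> g\<^sub>2) = \<tau> \<star> g\<^sub>1 \<star> g\<^sub>2\<close> for \<open>g\<^sub>j\<close> supported on
  the divisors of \<open>m\<^sub>j\<close>, with the finitely many dilates of \<open>\<tau>\<close> kept as separate summands so that
  each can be summed over \<open>n\<close> on its own.\<close>

lemma dirichlet_conv_of_divisor_sums:
  assumes "m1 > 0" "m2 > 0" "n > 0"
    and f1: "\<And>u. u > 0 \<Longrightarrow> f1 u = (\<Sum>a | a dvd m1. if a dvd u then g1 a else 0)"
    and f2: "\<And>u. u > 0 \<Longrightarrow> f2 u = (\<Sum>b | b dvd m2. if b dvd u then g2 b else 0)"
  shows "dirichlet_conv f1 f2 n = (\<Sum>a | a dvd m1. \<Sum>b | b dvd m2.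
           g1 a * g2 b * (if a * b dvd n then of_nat (divisor_tau (n div (a * b))) else 0))"
proof -
  have "dirichlet_conv f1 f2 n = (\<Sum>u | u dvd n. \<Sum>a | a dvd m1. \<Sum>b | b dvd m2.
          (if a dvd u then g1 a else 0) * (if b dvd n div u then g2 b else 0))"
    unfolding dirichlet_conv_def
  proof (intro sum.cong refl)
    fix u assume "u \<in> {u. u dvd n}"
    hence "u > 0" "n div u > 0"
      using \<open>n > 0\<close> by (auto dest: dvd_pos_nat simp: dvd_div_eq_0_iff)
    thus "f1 u * f2 (n div u) = (\<Sum>a | a dvd m1. \<Sum>b | b dvd m2.
          (if a dvd u then g1 a else 0) * (if b dvd n div u then g2 b else 0))"
      by (simp only: f1 f2 sum_product)
  qed
  also have "\<dots> = (\<Sum>a | a dvd m1. \<Sum>b | b dvd m2. \<Sum>u | u dvd n.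
          (if a dvd u then g1 a else 0) * (if b dvd n div u then g2 b else 0))"
    by (rule trans[OF sum.swap], rule sum.cong[OF refl], rule sum.swap)
  also have "\<dots> = (\<Sum>a | a dvd m1. \<Sum>b | b dvd m2.
           g1 a * g2 b * (if a * b dvd n then of_nat (divisor_tau (n div (a * b))) else 0))"
  proof (intro sum.cong refl)
    fix a b assume ab: "a \<in> {a. a dvd m1}" "b \<in> {b. b dvd m2}"
    hence pos: "a > 0" "b > 0" using \<open>m1 > 0\<close> \<open>m2 > 0\<close> by (auto dest: dvd_pos_nat)
    have "(\<Sum>u | u dvd n. (if a dvd u then g1 a else 0) * (if b dvd n div u then g2 b else 0)) =
          (\<Sum>u | u dvd n. if a dvd u \<and> b dvd n div u then g1 a * g2 b else 0)"
      by (intro sum.cong) auto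
    also have "\<dots> = (\<Sum>u\<in>{u. u dvd n} \<inter> {u. a dvd u \<and> b dvd n div u}. g1 a * g2 b)"
      using \<open>n > 0\<close> by (simp add: sum.If_cases)
    also have "{u. u dvd n} \<inter> {u. a dvd u \<and> b dvd n div u} = {u. u dvd n \<and> a dvd u \<and> b dvd n div u}"
      by blast
    finally show "(\<Sum>u | u dvd n. (if a dvd u then g1 a else 0) * (if b dvd n div u then g2 b else 0)) =
           g1 a * g2 b * (if a * b dvd n then of_nat (divisor_tau (n div (a * b))) else 0)"
      using card_divisor_pairs[OF \<open>n > 0\<close> pos] by simp
  qed
  finally show ?thesis .
qed

text \<open>The main terms of the divisor sums cancel exactly: \<open>ln (x / (a * b))\<close> is a sum of terms that
  depend on at most one of \<open>a\<close> and \<open>b\<close>, so every piece of the main term leaves one of the two variables with its bare weight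
  \<open>g a / a\<close>, and summing over that variable gives zero.\<close>

lemma summatory_conv_eq_sum_Delta:
  assumes "m1 > 0" "m2 > 0" "x > 0"
    and f1: "\<And>u. u > 0 \<Longrightarrow> f1 u = (\<Sum>a | a dvd m1. if a dvd u then g1 a else 0)"
    and f2: "\<And>u. u > 0 \<Longrightarrow> f2 u = (\<Sum>b | b dvd m2. if b dvd u then g2 b else 0)"
    and z1: "(\<Sum>a | a dvd m1. g1 a / of_nat a) = 0"
    and z2: "(\<Sum>b | b dvd m2. g2 b / of_nat b) = 0"
  shows "summatory (dirichlet_conv f1 f2) x = (\<Sum>a | a dvd m1. \<Sum>b | b dvd m2.
           g1 a * g2 b * of_real (divisor_Delta (x / real (a * b))))"
proof -
  define N where "N = {n. n > 0 \<and> real n \<le> x}"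
  define c where "c = ln x + 2 * euler_mascheroni - 1"
  define T where "T = summatory (\<lambda>n. real (divisor_tau n))"
  define s1 where "s1 = (\<lambda>a. g1 a / of_nat a)"
  define s2 where "s2 = (\<lambda>b. g2 b / of_nat b)"
  have S1: "(\<Sum>a | a dvd m1. s1 a) = 0" and S2: "(\<Sum>b | b dvd m2. s2 b) = 0"
    using z1 z2 by (simp_all add: s1_def s2_def)
  have "summatory (dirichlet_conv f1 f2) x = (\<Sum>n\<in>N. \<Sum>a | a dvd m1. \<Sum>b | b dvd m2.
          g1 a * g2 b * (if a * b dvd n then of_nat (divisor_tau (n div (a * b))) else 0))"
    unfolding summatory_def N_def
    by (intro sum.cong refl dirichlet_conv_of_divisor_sums) (use assms in auto)
  also have "\<dots> = (\<Sum>a | a dvd m1. \<Sum>b | b dvd m2. \<Sum>n\<in>N.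
          g1 a * g2 b * (if a * b dvd n then of_nat (divisor_tau (n div (a * b))) else 0))"
    by (rule trans[OF sum.swap], rule sum.cong[OF refl], rule sum.swap)
  also have "\<dots> = (\<Sum>a | a dvd m1. \<Sum>b | b dvd m2.
          g1 a * g2 b * of_real (divisor_Delta (x / real (a * b))) +
          of_real x * (of_real c * s1 a * s2 b - (s1 a * of_real (ln (real a))) * s2 b
             - s1 a * (s2 b * of_real (ln (real b)))))"
  proof (intro sum.cong refl)
    fix a b assume "a \<in> {a. a dvd m1}" "b \<in> {b. b dvd m2}"
    hence pos: "a > 0" "b > 0" using \<open>m1 > 0\<close> \<open>m2 > 0\<close> by (auto dest: dvd_pos_nat)
    have "(\<Sum>n\<in>N. g1 a * g2 b * (if a * b dvd n then of_nat (divisor_tau (n div (a * b))) else 0)) =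
          g1 a * g2 b * of_real (T (x / real (a * b)))"
      unfolding N_def T_def sum_distrib_left[symmetric]
      by (subst summatory_tau_multiples) (use pos in auto)
    also have "T (x / real (a * b)) = divisor_Delta (x / real (a * b)) +
                 x / (real a * real b) * (c - ln (real a) - ln (real b))"
      using pos \<open>x > 0\<close> unfolding divisor_Delta_def T_def c_def
      by (simp add: ln_div ln_mult algebra_simps add_divide_distrib diff_divide_distrib)
    finally show "(\<Sum>n\<in>N. g1 a * g2 b * (if a * b dvd n then of_nat (divisor_tau (n div (a * b))) else 0)) =
          g1 a * g2 b * of_real (divisor_Delta (x / real (a * b))) +
          of_real x * (of_real c * s1 a * s2 b - (s1 a * of_real (ln (real a))) * s2 b
             - s1 a * (s2 b * of_real (ln (real b))))"
      unfolding s1_def s2_def by (simp add: algebra_simps add_divide_distrib diff_divide_distrib)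
  qed
  also have "\<dots> = (\<Sum>a | a dvd m1. \<Sum>b | b dvd m2.
           g1 a * g2 b * of_real (divisor_Delta (x / real (a * b)))) +
       of_real x * (\<Sum>a | a dvd m1. of_real c * s1 a * (\<Sum>b | b dvd m2. s2 b)
          - (s1 a * of_real (ln (real a))) * (\<Sum>b | b dvd m2. s2 b)
          - s1 a * (\<Sum>b | b dvd m2. s2 b * of_real (ln (real b))))"
    by (simp add: sum.distrib sum_subtractf sum_distrib_left right_diff_distrib mult.assoc)
  also have "(\<Sum>a | a dvd m1. of_real c * s1 a * (\<Sum>b | b dvd m2. s2 b)
          - (s1 a * of_real (ln (real a))) * (\<Sum>b | b dvd m2. s2 b)
          - s1 a * (\<Sum>b | b dvd m2. s2 b * of_real (ln (real b)))) = 0"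
    by (simp add: S1 S2 sum_negf flip: sum_distrib_right)
  finally show ?thesis by simp
qed

section \<open>Growth of the error term\<close>

text \<open>A crude bound, from \<open>\<tau> n \<le> n\<close>. It shows that the set of admissible exponents is nonempty,
  without which its infimum would carry no information.\<close>

lemma divisor_Delta_bigo_square: "divisor_Delta \<in> O(\<lambda>x. x powr 2)"
proof -
  have bound: "norm (summatory (\<lambda>n. real (divisor_tau n)) x) \<le> 1 * norm (x powr 2)" if "x \<ge> 1" for x
  proof -
    have "divisor_tau n \<le> n" if "n > 0" for n
    proof -
      have "{d. d dvd n} \<subseteq> {1..n}" using that by (auto dest: dvd_imp_le dvd_pos_nat intro!: Suc_leI)
      from card_mono[OF _ this] show ?thesis by (simp add: divisor_tau_def)
    qed
    hence "real (divisor_tau n) \<le> x" if "n > 0" "real n \<le> x" for n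
      using that by (meson of_nat_le_iff order.trans)
    hence "(\<Sum>n | n > 0 \<and> real n \<le> x. real (divisor_tau n)) \<le> (\<Sum>n | n > 0 \<and> real n \<le> x. x)"
      by (intro sum_mono) simp
    also have "\<dots> = real (card {n. n > 0 \<and> real n \<le> x}) * x" by simp
    also have "\<dots> \<le> x * x"
    proof (rule mult_right_mono)
      have "{n. n > 0 \<and> real n \<le> x} = {1..nat \<lfloor>x\<rfloor>}"
        using \<open>x \<ge> 1\<close> by (auto simp: le_nat_floor le_nat_iff le_floor_iff)
      thus "real (card {n. n > 0 \<and> real n \<le> x}) \<le> x"
        using \<open>x \<ge> 1\<close> by simp
    qed (use \<open>x \<ge> 1\<close> in simp)
    finally show ?thesis
      using \<open>x \<ge> 1\<close> by (simp add: summatory_def sum_nonneg powr_numeral power2_eq_square)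
  qed
  have "summatory (\<lambda>n. real (divisor_tau n)) \<in> O(\<lambda>x. x powr 2)"
    using bound by (intro bigoI[where c = 1] eventually_mono[OF eventually_ge_at_top[of 1]])
  moreover have "(\<lambda>x::real. x * ln x + (2 * euler_mascheroni - 1) * x) \<in> O(\<lambda>x. x powr 2)"
    by real_asymp
  ultimately show ?thesis
    unfolding divisor_Delta_def by (rule sum_in_bigo)
qed

lemma divisor_Delta_scaled_bigo:
  assumes "k > 0" "\<epsilon> > 0"
  shows "(\<lambda>x. divisor_Delta (x / real k)) \<in> O(\<lambda>x. x powr (divisor_alpha + \<epsilon>))"
proof -
  let ?A = "{a :: real. a > 0 \<and> divisor_Delta \<in> O(\<lambda>x. x powr a)}"
  have "2 \<in> ?A" using divisor_Delta_bigo_square by simp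
  moreover have "Inf ?A < divisor_alpha + \<epsilon>"
    using assms by (simp add: divisor_alpha_def)
  ultimately obtain a where a: "divisor_Delta \<in> O(\<lambda>x. x powr a)" "a < divisor_alpha + \<epsilon>"
    using cInf_lessD[of ?A] by blast
  have "filterlim (\<lambda>x. x / real k) at_top at_top"
    using assms by real_asymp
  from landau_o.big.compose[OF a(1) this]
  have "(\<lambda>x. divisor_Delta (x / real k)) \<in> O(\<lambda>x. (x / real k) powr a)" .
  also have "(\<lambda>x. (x / real k) powr a) \<in> O(\<lambda>x. x powr (divisor_alpha + \<epsilon>))"
    using assms a(2) by real_asymp
  finally show ?thesis .
qed

section \<open>The summatory function of the convolution\<close>

theorem corollary1p1:
  fixes m1 m2 :: nat and f1 f2 :: "nat \<Rightarrow> complex"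
  assumes "m1 > 0" and "m2 > 0"
    and "multiplicative_fun f1" and "multiplicative_fun f2"
    and "has_period f1 m1" and "has_period f2 m2"
    and "\<exists>q. prime q \<and> q dvd m1 \<and> (\<lambda>k. f1 (q ^ k) / of_nat (q ^ k)) sums 0"
    and "\<exists>q. prime q \<and> q dvd m2 \<and> (\<lambda>k. f2 (q ^ k) / of_nat (q ^ k)) sums 0"
    and "\<And>p k. prime p \<Longrightarrow> p dvd m1 \<Longrightarrow> k \<ge> multiplicity p m1 \<Longrightarrow>
           f1 (p ^ k) = f1 (p ^ multiplicity p m1)"
    and "\<And>p k. prime p \<Longrightarrow> p dvd m2 \<Longrightarrow> k \<ge> multiplicity p m2 \<Longrightarrow>
           f2 (p ^ k) = f2 (p ^ multiplicity p m2)"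
    and "\<And>p k. prime p \<Longrightarrow> coprime p m1 \<Longrightarrow> k \<ge> 1 \<Longrightarrow> f1 (p ^ k) = 1"
    and "\<And>p k. prime p \<Longrightarrow> coprime p m2 \<Longrightarrow> k \<ge> 1 \<Longrightarrow> f2 (p ^ k) = 1"
  shows "\<forall>\<epsilon>>0. summatory (dirichlet_conv f1 f2) \<in>
           O(\<lambda>x::real. complex_of_real (x powr (divisor_alpha + \<epsilon>)))"
proof (intro allI impI)
  fix \<epsilon> :: real assume "\<epsilon> > 0"
  let ?g1 = "mobius_transform f1" and ?g2 = "mobius_transform f2"
  note supp1 = mobius_transform_support[OF assms(3,1) _ _ assms(9,11)]
  note supp2 = mobius_transform_support[OF assms(4,2) _ _ assms(10,12)]
  obtain q1 where q1: "prime q1" "(\<lambda>k. f1 (q1 ^ k) / of_nat (q1 ^ k)) sums 0"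
    using assms(7) by blast
  obtain q2 where q2: "prime q2" "(\<lambda>k. f2 (q2 ^ k) / of_nat (q2 ^ k)) sums 0"
    using assms(8) by blast
  note formula = summatory_conv_eq_sum_Delta[OF assms(1,2) _
    finite_divisor_sum[OF assms(3,1) _ supp1] finite_divisor_sum[OF assms(4,2) _ supp2]
    sum_mobius_transform_over_d_eq_0[OF assms(3,1) q1 supp1]
    sum_mobius_transform_over_d_eq_0[OF assms(4,2) q2 supp2]]
  have "(\<lambda>x. \<Sum>a | a dvd m1. \<Sum>b | b dvd m2.
           ?g1 a * ?g2 b * of_real (divisor_Delta (x / real (a * b)))) \<in>
        O(\<lambda>x::real. complex_of_real (x powr (divisor_alpha + \<epsilon>)))"
  proof (intro big_sum_in_bigo)
    fix a b assume "a \<in> {a. a dvd m1}" "b \<in> {b. b dvd m2}"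
    hence "a * b > 0" using \<open>m1 > 0\<close> \<open>m2 > 0\<close> by (auto dest: dvd_pos_nat)
    from divisor_Delta_scaled_bigo[OF this \<open>\<epsilon> > 0\<close>]
    have "(\<lambda>x. complex_of_real (divisor_Delta (x / real (a * b)))) \<in>
            O(\<lambda>x. complex_of_real (x powr (divisor_alpha + \<epsilon>)))"
      by (simp only: landau_o.big.of_real_iff)
    thus "(\<lambda>x. ?g1 a * ?g2 b * of_real (divisor_Delta (x / real (a * b)))) \<in>
            O(\<lambda>x. complex_of_real (x powr (divisor_alpha + \<epsilon>)))"
      by simp
  qed
  also have "?this \<longleftrightarrow> summatory (dirichlet_conv f1 f2) \<in>
               O(\<lambda>x::real. complex_of_real (x powr (divisor_alpha + \<epsilon>)))"
    by (intro landau_o.big.in_cong eventually_mono[OF eventually_gt_at_top[of 0]])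
       (simp add: formula)
  finally show "summatory (dirichlet_conv f1 f2) \<in>
               O(\<lambda>x::real. complex_of_real (x powr (divisor_alpha + \<epsilon>)))" .
qed

end
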